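(* Let $n\ge 1$ be an integer and let $\Delta(SD_{8n})$ be the commuting graph of $SD_{8n}$. Then: (i) if $n\ge 2$, the vertex connectivity is $\kappa(\Delta(SD_{8n}))=2$ if $n$ is even, and $\kappa(\Delta(SD_{8n}))=4$ if $n$ is odd; (ii) the independence number is $\alpha(\Delta(SD_{8n}))=1$ if $n=1$; $\alpha(\Delta(SD_{8n}))=2n+1$ if $n$ is even; and $\alpha(\Delta(SD_{8n}))=n+1$ otherwise (i.e. if $n\geq 3$ is odd); (iii) the matching number of $\Delta(SD_{8n})$ is $4n$.
   Context: For an integer $n\ge 1$, $SD_{8n}=\langle a,b : a^{4n}=b^2=e,\ ba=a^{2n-1}b\rangle$, a group of order $8n$ (semidihedral group). The commuting graph $\Delta(G)$ of a group $G$ is the simple graph with vertex set $G$ in which two distinct vertices $x,y$ are adjacent iff $xy=yx$. The vertex connectivity $\kappa(\Gamma)$ of a connected graph is the minimum size of a set of vertices whose deletion increases the number of connected components. The independence number $\alpha(\Gamma)$ is the maximum size of a set of pairwise non-adjacent vertices. The matching number is the maximum number of edges in a set of pairwise disjoint edges. *)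

theory Defs
  imports "HOL-Algebra.Group" "HOL-Library.Disjoint_Sets" "Graph_Theory.Graph_Theory"
begin

section \<open>Groups given by generators and relations\<close>

text \<open>
  The letter \<open>(g, True)\<close> stands for the generator \<open>g\<close>, and \<open>(g, False)\<close> for its formal inverse.
  All elements of the type \<open>'g\<close> are generators.
\<close>

type_synonym 'g gword = "('g \<times> bool) list"

text \<open>
  The least congruence on words that contains the relations \<open>R\<close> (a pair \<open>(u, v)\<close> is read as
  \<open>u = v\<close>) and makes \<open>(g, True)\<close> and \<open>(g, False)\<close> mutually inverse.
\<close>

inductive gword_eq :: "('g gword \<times> 'g gword) set \<Rightarrow> 'g gword \<Rightarrow> 'g gword \<Rightarrow> bool"
  for R :: "('g gword \<times> 'g gword) set" where
  refl: "gword_eq R u u"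
| sym: "gword_eq R u v \<Longrightarrow> gword_eq R v u"
| trans: "gword_eq R u v \<Longrightarrow> gword_eq R v w \<Longrightarrow> gword_eq R u w"
| append: "gword_eq R u u' \<Longrightarrow> gword_eq R v v' \<Longrightarrow> gword_eq R (u @ v) (u' @ v')"
| cancel: "gword_eq R [(g, s), (g, \<not> s)] []"
| relation: "(u, v) \<in> R \<Longrightarrow> gword_eq R u v"

definition presented_group :: "('g gword \<times> 'g gword) set \<Rightarrow> 'g gword set monoid" where
  "presented_group R =
    \<lparr> carrier = UNIV // {(u, v). gword_eq R u v},
      monoid.mult = (\<lambda>X Y. {w. \<exists>u\<in>X. \<exists>v\<in>Y. gword_eq R (u @ v) w}),
      one = {w. gword_eq R [] w} \<rparr>"

lemma equiv_gword_eq: "equiv UNIV {(u, v). gword_eq R u v}"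
  by (rule equivI) (auto simp: refl_on_def sym_def trans_def
      intro: gword_eq.refl gword_eq.sym gword_eq.trans)

lemma carrier_presented_group:
  "X \<in> carrier (presented_group R) \<longleftrightarrow> (\<exists>u. X = {w. gword_eq R u w})"
  by (auto simp: presented_group_def quotient_def)

lemma mult_presented_group:
  "{w. gword_eq R u w} \<otimes>\<^bsub>presented_group R\<^esub> {w. gword_eq R v w} = {w. gword_eq R (u @ v) w}"
  by (auto simp: presented_group_def intro: gword_eq.refl gword_eq.trans gword_eq.append)

lemma one_presented_group: "\<one>\<^bsub>presented_group R\<^esub> = {w. gword_eq R [] w}"
  by (simp add: presented_group_def)

lemma gword_eq_left_inverse:
  "gword_eq R (rev (map (\<lambda>(g, s). (g, \<not> s)) u) @ u) []"
proof (induction u)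
  case Nil
  show ?case by (simp add: gword_eq.refl)
next
  case (Cons x u)
  obtain g s where x: "x = (g, s)" by force
  let ?i = "rev (map (\<lambda>(g, s). (g, \<not> s)) u)"
  have "gword_eq R ([(g, \<not> s), (g, \<not> \<not> s)] @ u) ([] @ u)"
    by (intro gword_eq.append gword_eq.cancel gword_eq.refl)
  then have "gword_eq R (?i @ [(g, \<not> s), (g, s)] @ u) (?i @ u)"
    using gword_eq.append[OF gword_eq.refl] by fastforce
  then show ?case using Cons.IH by (auto simp: x intro: gword_eq.trans)
qed

lemma group_presented_group: "group (presented_group R)"
proof (rule groupI)
  fix X assume "X \<in> carrier (presented_group R)"
  then obtain u where X: "X = {w. gword_eq R u w}" by (auto simp: carrier_presented_group)
  let ?Y = "{w. gword_eq R (rev (map (\<lambda>(g, s). (g, \<not> s)) u)) w}"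
  have "?Y \<otimes>\<^bsub>presented_group R\<^esub> X = \<one>\<^bsub>presented_group R\<^esub>"
    using gword_eq_left_inverse[of R u]
    by (auto simp: X mult_presented_group one_presented_group
        intro: gword_eq.trans gword_eq.sym)
  moreover have "?Y \<in> carrier (presented_group R)" by (auto simp: carrier_presented_group)
  ultimately show "\<exists>Y\<in>carrier (presented_group R). Y \<otimes>\<^bsub>presented_group R\<^esub> X = \<one>\<^bsub>presented_group R\<^esub>"
    by blast
qed (auto simp: carrier_presented_group mult_presented_group one_presented_group)


section \<open>The semidihedral group\<close>

datatype sd_gen = Gen_a | Gen_b

text \<open>
  The parameter is \<open>n\<close>, so the group has order \<open>8 * n\<close>. The truncated subtraction \<open>2 * n - 1\<close> is
  the intended exponent for \<open>n \<ge> 1\<close>.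
\<close>

definition SD :: "nat \<Rightarrow> sd_gen gword set monoid" where
  "SD n = (let a = (Gen_a, True); b = (Gen_b, True) in
    presented_group
      {(replicate (4 * n) a, []),
       ([b, b], []),
       ([b, a], replicate (2 * n - 1) a @ [b])})"


section \<open>Graphs\<close>

text \<open>
  An undirected simple graph is a symmetric loop-free digraph without parallel arcs, as in the
  locale \<open>graph\<close>: each undirected edge is represented by both of its orientations.
\<close>

definition commuting_graph :: "('a, 'm) monoid_scheme \<Rightarrow> ('a, 'a \<times> 'a) pre_digraph" where
  "commuting_graph G = with_proj
    \<lparr> pverts = carrier G,
      parcs = {(x, y). x \<in> carrier G \<and> y \<in> carrier G \<and> x \<noteq> y \<and> x \<otimes>\<^bsub>G\<^esub> y = y \<otimes>\<^bsub>G\<^esub> x} \<rparr>"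

lemma graph_commuting_graph:
  assumes "finite (carrier G)"
  shows "graph (commuting_graph G)"
proof -
  have "finite {(x, y). x \<in> carrier G \<and> y \<in> carrier G \<and> x \<noteq> y \<and> x \<otimes>\<^bsub>G\<^esub> y = y \<otimes>\<^bsub>G\<^esub> x}"
    by (rule finite_subset[of _ "carrier G \<times> carrier G"]) (use assms in auto)
  then show ?thesis
    using assms unfolding commuting_graph_def
    by unfold_locales (auto simp: arc_to_ends_def symmetric_def sym_def)
qed

text \<open>In a symmetric digraph the strongly connected components are the connected components.\<close>

definition num_components :: "('a, 'b) pre_digraph \<Rightarrow> nat" where
  "num_components G = card (pre_digraph.sccs_verts G)"

text \<open>
  Here \<open>Inf\<close> is the minimum; it is \<open>0\<close> if no vertex set separates the graph (complete graphs).
\<close>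

definition vertex_connectivity :: "('a, 'b) pre_digraph \<Rightarrow> nat" where
  "vertex_connectivity G =
    Inf {card S | S. S \<subseteq> verts G \<and> finite S \<and>
      num_components (G \<restriction> (verts G - S)) > num_components G}"

definition independent_set :: "('a, 'b) pre_digraph \<Rightarrow> 'a set \<Rightarrow> bool" where
  "independent_set G S \<longleftrightarrow> S \<subseteq> verts G \<and> (\<forall>x\<in>S. \<forall>y\<in>S. x \<noteq> y \<longrightarrow> \<not> x \<rightarrow>\<^bsub>G\<^esub> y)"

definition independence_number :: "('a, 'b) pre_digraph \<Rightarrow> nat" where
  "independence_number G = Max {card S | S. independent_set G S}"

definition undirected_edges :: "('a, 'b) pre_digraph \<Rightarrow> 'a set set" where
  "undirected_edges G = {{x, y} | x y. x \<rightarrow>\<^bsub>G\<^esub> y}"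

definition matching :: "('a, 'b) pre_digraph \<Rightarrow> 'a set set \<Rightarrow> bool" where
  "matching G M \<longleftrightarrow> M \<subseteq> undirected_edges G \<and> disjoint M"

definition matching_number :: "('a, 'b) pre_digraph \<Rightarrow> nat" where
  "matching_number G = Max {card M | M. matching G M}"

end

theory Submission
  imports Defs
begin

text \<open>
  Outside the center, commutation in the semidihedral group is an equivalence relation: the
  noncentral powers of \<open>a\<close> form one class, and \<open>a ^ i * b\<close>, \<open>a ^ j * b\<close> commute iff \<open>i\<close> and \<open>j\<close>
  agree modulo \<open>m\<close>, where \<open>m = 2 * n\<close> for even \<open>n\<close> and \<open>m = n\<close> for odd \<open>n\<close>. The commuting graph
  therefore consists of disjoint cliques together with the universal vertices of the center. Thus
  for noncommutative groups of this kind the connectivity is the order of the center and the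
  independence number is the number of classes. Multiplication by the central involution
  \<open>a ^ (2 * n)\<close> pairs off all vertices and yields a perfect matching.
\<close>

section \<open>Commuting graphs of finite groups\<close>

definition center :: "('a, 'm) monoid_scheme \<Rightarrow> 'a set" where
  "center G = {z \<in> carrier G. \<forall>x\<in>carrier G. z \<otimes>\<^bsub>G\<^esub> x = x \<otimes>\<^bsub>G\<^esub> z}"

lemma center_subset: "center G \<subseteq> carrier G"
  by (auto simp: center_def)

lemma verts_commuting_graph [simp]: "verts (commuting_graph G) = carrier G"
  by (simp add: commuting_graph_def)

lemma dominates_commuting_graph [simp]:
  "x \<rightarrow>\<^bsub>commuting_graph G\<^esub> y \<longleftrightarrow>
    x \<in> carrier G \<and> y \<in> carrier G \<and> x \<noteq> y \<and> x \<otimes>\<^bsub>G\<^esub> y = y \<otimes>\<^bsub>G\<^esub> x"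
  by (auto simp: commuting_graph_def arcs_ends_def arc_to_ends_def)

section \<open>Connected components and vertex connectivity\<close>

lemma dominates_induce_subgraph:
  "x \<rightarrow>\<^bsub>H \<restriction> V\<^esub> y \<longleftrightarrow> x \<rightarrow>\<^bsub>H\<^esub> y \<and> x \<in> V \<and> y \<in> V"
  by (auto simp: arcs_ends_def arc_to_ends_def)

text \<open>Any two vertices are joined through \<open>x\<close>, so the whole vertex set is the
  only strong component.\<close>

lemma num_components_eq_1I:
  assumes "x \<in> verts H" "\<And>y. y \<in> verts H \<Longrightarrow> x = y \<or> x \<rightarrow>\<^bsub>H\<^esub> y \<and> y \<rightarrow>\<^bsub>H\<^esub> x"
  shows "num_components H = 1"
proof -
  have "x \<rightarrow>\<^sup>*\<^bsub>H\<^esub> y \<and> y \<rightarrow>\<^sup>*\<^bsub>H\<^esub> x" if "y \<in> verts H" for y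
    using assms(2)[OF that] assms(1) that unfolding reachable_def
    by (auto intro: rtrancl_on.intros)
  then have all: "u \<rightarrow>\<^sup>*\<^bsub>H\<^esub> v" if "u \<in> verts H" "v \<in> verts H" for u v
    using that unfolding reachable_def by (meson rtrancl_on_trans)
  have mem: "u \<in> verts H \<and> v \<in> verts H" if "u \<rightarrow>\<^sup>*\<^bsub>H\<^esub> v" for u v
    using that unfolding reachable_def by (auto dest: in_rtrancl_on_in_F)
  have "pre_digraph.sccs_verts H = {verts H}"
    unfolding pre_digraph.sccs_verts_def using all mem assms(1) by blast
  then show ?thesis by (simp add: num_components_def)
qed

lemma num_components_ge_2I:
  assumes "finite (verts H)" "x \<in> verts H" "y \<in> verts H" "\<not> x \<rightarrow>\<^sup>*\<^bsub>H\<^esub> y"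
  shows "num_components H \<ge> 2"
proof -
  define C where "C u = {v. u \<rightarrow>\<^sup>*\<^bsub>H\<^esub> v \<and> v \<rightarrow>\<^sup>*\<^bsub>H\<^esub> u}" for u
  have self: "u \<in> C u" if "u \<in> verts H" for u
    using that by (simp add: C_def reachable_def)
  have C: "C u \<in> pre_digraph.sccs_verts H" if "u \<in> verts H" for u
    unfolding pre_digraph.sccs_verts_def using self[OF that]
    by (auto simp: C_def reachable_def intro: rtrancl_on_trans)
  have "pre_digraph.sccs_verts H \<subseteq> Pow (verts H)"
    unfolding pre_digraph.sccs_verts_def reachable_def by (auto dest: in_rtrancl_on_in_F)
  \<comment> \<open>An infinite set has \<open>card\<close> 0, so the lower bound needs finiteness
    of the set of components.\<close>
  then have fin: "finite (pre_digraph.sccs_verts H)"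
    using assms(1) by (meson finite_Pow_iff finite_subset)
  have "C x \<noteq> C y" using self[OF assms(3)] assms(4) by (auto simp: C_def)
  then have "card {C x, C y} = 2" by simp
  then show ?thesis
    unfolding num_components_def using card_mono[OF fin, of "{C x, C y}"] C assms(2,3) by simp
qed

text \<open>A surviving central element is adjacent to every other remaining vertex, so a separating
  set must contain the center. Deleting exactly the center does separate: every remaining edge
  preserves \<open>f\<close>, while \<open>x\<close> and \<open>y\<close> have different
  values.\<close>

lemma vertex_connectivity_commuting_graph:
  assumes "monoid G" "finite (carrier G)"
    and f: "\<And>x y. x \<in> carrier G - center G \<Longrightarrow> y \<in> carrier G - center G \<Longrightarrow>
      x \<otimes>\<^bsub>G\<^esub> y = y \<otimes>\<^bsub>G\<^esub> x \<longleftrightarrow> f x = f y"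
    and x: "x \<in> carrier G - center G" and y: "y \<in> carrier G - center G" and ne: "f x \<noteq> f y"
  shows "vertex_connectivity (commuting_graph G) = card (center G)"
proof -
  let ?D = "commuting_graph G"
  interpret monoid G by fact
  have universal: "num_components (?D \<restriction> V) = 1" if "V \<subseteq> carrier G" "z \<in> V" "z \<in> center G" for V z
  proof (rule num_components_eq_1I)
    show "z \<in> verts (?D \<restriction> V)" using that by simp
    fix y assume "y \<in> verts (?D \<restriction> V)"
    then have "y \<in> carrier G" "y \<in> V" "z \<otimes>\<^bsub>G\<^esub> y = y \<otimes>\<^bsub>G\<^esub> z"
      using that by (auto simp: center_def)
    then show "z = y \<or> z \<rightarrow>\<^bsub>?D \<restriction> V\<^esub> y \<and> y \<rightarrow>\<^bsub>?D \<restriction> V\<^esub> z"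
      using that by (auto simp: dominates_induce_subgraph)
  qed
  \<comment> \<open>The identity is adjacent to every other vertex.\<close>
  have one: "num_components ?D = 1"
    by (rule num_components_eq_1I[of "\<one>\<^bsub>G\<^esub>"]) auto
  have le: "card (center G) \<le> card S"
    if "S \<subseteq> carrier G" "num_components (?D \<restriction> (carrier G - S)) > 1" for S
  proof -
    have "center G \<subseteq> S"
    proof (rule subsetI, rule ccontr)
      fix z assume "z \<in> center G" "z \<notin> S"
      then have "num_components (?D \<restriction> (carrier G - S)) = 1"
        using center_subset[of G] by (intro universal[of _ z]) auto
      then show False using that(2) by simp
    qed
    then show ?thesis using that assms(2) by (meson card_mono finite_subset)
  qed
  let ?H = "?D \<restriction> (carrier G - center G)"
  have "f u = f v" if "u \<rightarrow>\<^sup>*\<^bsub>?H\<^esub> v" for u v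
    using that unfolding reachable_def
    by (induction rule: rtrancl_on_induct) (auto simp: dominates_induce_subgraph f)
  then have "num_components ?H \<ge> 2"
    using assms(2) x y ne by (intro num_components_ge_2I[of _ x y]) auto
  moreover have "finite (center G)" using center_subset assms(2) by (rule finite_subset)
  ultimately have "card (center G) \<in> {card S |S. S \<subseteq> verts ?D \<and> finite S \<and>
      num_components (?D \<restriction> (verts ?D - S)) > num_components ?D}"
    using one center_subset[of G] by (intro CollectI exI[of _ "center G"]) simp
  then show ?thesis
    unfolding vertex_connectivity_def by (rule cInf_eq_minimum) (use one le in auto)
qed

section \<open>The independence number\<close>

lemma independence_number_eqI:
  assumes "independent_set H S" "card S = k" "\<And>T. independent_set H T \<Longrightarrow> card T \<le> k"
  shows "independence_number H = k"
  unfolding independence_number_def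
proof (rule Max_eqI)
  show "finite {card S |S. independent_set H S}"
    unfolding finite_nat_set_iff_bounded_le using assms(3) by blast
qed (use assms in auto)

lemma independent_set_center:
  assumes "independent_set (commuting_graph G) T" "z \<in> T" "z \<in> center G"
  shows "T = {z}"
  using assms unfolding independent_set_def center_def by fastforce

lemma independence_number_commutative:
  assumes "monoid G" "center G = carrier G"
  shows "independence_number (commuting_graph G) = 1"
proof (rule independence_number_eqI)
  interpret monoid G by fact
  show "independent_set (commuting_graph G) {\<one>\<^bsub>G\<^esub>}" by (simp add: independent_set_def)
  fix T assume T: "independent_set (commuting_graph G) T"
  show "card T \<le> 1"
  proof (cases "T = {}")
    case False
    then obtain z where "z \<in> T" by blast
    then have "T = {z}"
      using independent_set_center[OF T] assms(2) T by (auto simp: independent_set_def)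
    then show ?thesis by simp
  qed simp
qed simp

text \<open>One representative from each fibre of \<open>f\<close> gives an independent set.
  Conversely, \<open>f\<close> is injective on an independent set that avoids the center, and one
  that meets the center is a singleton.\<close>

lemma independence_number_commuting_graph:
  assumes fin: "finite (carrier G)" and noncentral: "center G \<noteq> carrier G"
    and f: "\<And>x y. x \<in> carrier G - center G \<Longrightarrow> y \<in> carrier G - center G \<Longrightarrow>
      x \<otimes>\<^bsub>G\<^esub> y = y \<otimes>\<^bsub>G\<^esub> x \<longleftrightarrow> f x = f y"
  shows "independence_number (commuting_graph G) = card (f ` (carrier G - center G))"
proof -
  let ?N = "carrier G - center G"
  obtain S where S: "S \<subseteq> ?N" "inj_on f S" "f ` S = f ` ?N"
    by (metis subset_image_inj order_refl)
  \<comment> \<open>Covers the independent singletons of central elements: a noncentral element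
    exists, so there is at least one class.\<close>
  have pos: "card (f ` ?N) \<ge> 1"
    using fin noncentral center_subset[of G] by (simp add: Suc_le_eq card_gt_0_iff)
  show ?thesis
  proof (rule independence_number_eqI)
    show "independent_set (commuting_graph G) S"
      unfolding independent_set_def
    proof (intro conjI ballI impI)
      show "S \<subseteq> verts (commuting_graph G)" using S(1) by auto
      fix x y assume xy: "x \<in> S" "y \<in> S" "x \<noteq> y"
      then have "f x \<noteq> f y" using S(2) by (meson inj_onD)
      then show "\<not> x \<rightarrow>\<^bsub>commuting_graph G\<^esub> y" using f[of x y] xy S(1) by auto
    qed
    show "card S = card (f ` ?N)" using S card_image by metis
    fix T assume T: "independent_set (commuting_graph G) T"
    show "card T \<le> card (f ` ?N)"
    proof (cases "T \<inter> center G = {}")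
      case True
      then have "T \<subseteq> ?N" using T by (auto simp: independent_set_def)
      moreover have "inj_on f T"
      proof (rule inj_onI, rule ccontr)
        fix x y assume xy: "x \<in> T" "y \<in> T" "f x = f y" "x \<noteq> y"
        then have "x \<in> ?N" "y \<in> ?N" using \<open>T \<subseteq> ?N\<close> by auto
        then have "x \<rightarrow>\<^bsub>commuting_graph G\<^esub> y" using f xy by auto
        then show False using T xy by (auto simp: independent_set_def)
      qed
      ultimately show ?thesis using fin by (intro card_inj_on_le[of f]) auto
    next
      case False
      then obtain z where "T = {z}" using independent_set_center[OF T] by blast
      then show ?thesis using pos by simp
    qed
  qed
qed

section \<open>The matching number\<close>

lemma edge_commuting_graph:
  "e \<in> undirected_edges (commuting_graph G) \<Longrightarrow> e \<subseteq> carrier G \<and> card e = 2"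
  by (auto simp: undirected_edges_def)

lemma card_Union_matching:
  assumes fin: "finite (carrier G)" and M: "matching (commuting_graph G) M"
  shows "card (\<Union>M) = 2 * card M"
proof -
  have edge: "e \<subseteq> carrier G \<and> card e = 2" if "e \<in> M" for e
    using M that edge_commuting_graph unfolding matching_def by blast
  have "card (\<Union>M) = sum card M"
  proof (rule card_Union_disjoint)
    show "pairwise disjnt M"
      using M by (simp add: matching_def disjoint_def pairwise_def disjnt_def)
    show "finite e" if "e \<in> M" for e
      using edge[OF that] fin by (blast intro: finite_subset)
  qed
  then show ?thesis using edge by simp
qed

text \<open>Multiplication by \<open>z\<close> is an involution without fixed points that sends each
  element to one commuting with it. Its orbits are therefore edges that partition the group, and no
  matching can cover more vertices.\<close>

lemma (in group) matching_number_commuting_graph: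
  assumes fin: "finite (carrier G)"
    and z: "z \<in> center G" "z \<otimes> z = \<one>" "z \<noteq> \<one>"
  shows "matching_number (commuting_graph G) = card (carrier G) div 2"
proof -
  let ?M = "(\<lambda>x. {x, z \<otimes> x}) ` carrier G"
  have zc [simp]: "z \<in> carrier G" using center_subset z(1) by (rule subsetD)
  have zz: "z \<otimes> (z \<otimes> x) = x" if "x \<in> carrier G" for x
    using that z(2) m_assoc[of z z x] by simp
  have zx: "z \<otimes> x \<noteq> x" if "x \<in> carrier G" for x
    using that z(3) by simp
  have comm: "x \<otimes> (z \<otimes> x) = z \<otimes> x \<otimes> x" if "x \<in> carrier G" for x
  proof -
    have "z \<otimes> x = x \<otimes> z" using that z(1) unfolding center_def by blast
    then show ?thesis using that by (metis m_assoc zc)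
  qed
  have "?M \<subseteq> undirected_edges (commuting_graph G)"
  proof clarify
    fix x assume "x \<in> carrier G"
    then show "{x, z \<otimes> x} \<in> undirected_edges (commuting_graph G)"
      unfolding undirected_edges_def
      using zx[of x] comm[of x] by (intro CollectI exI[of _ x] exI[of _ "z \<otimes> x"]) simp
  qed
  moreover have "disjoint ?M"
  proof (rule disjointI)
    fix e e' assume "e \<in> ?M" "e' \<in> ?M" "e \<noteq> e'"
    then obtain x y where xy: "x \<in> carrier G" "y \<in> carrier G" "e = {x, z \<otimes> x}" "e' = {y, z \<otimes> y}"
      by blast
    \<comment> \<open>An orbit is determined by either of its two members, so orbits that meet are
      equal.\<close>
    have "{u, z \<otimes> u} = {v, z \<otimes> v}" if "u \<in> {v, z \<otimes> v}" "v \<in> carrier G" for u v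
      using that zz[of v] by (elim insertE emptyE) (simp_all only: insert_commute)
    then show "e \<inter> e' = {}" using xy \<open>e \<noteq> e'\<close> by (metis disjoint_iff)
  qed
  ultimately have M: "matching (commuting_graph G) ?M" by (simp add: matching_def)
  have "\<Union>?M = carrier G" using m_closed[OF zc] by blast
  then have max: "card ?M = card (carrier G) div 2" using card_Union_matching[OF fin M] by simp
  have le: "card M \<le> card (carrier G) div 2" if "matching (commuting_graph G) M" for M
  proof -
    have "\<Union>M \<subseteq> carrier G"
      using that edge_commuting_graph unfolding matching_def by blast
    then have "card (\<Union>M) \<le> card (carrier G)" using fin by (rule card_mono[rotated])
    then show ?thesis using card_Union_matching[OF fin that] by simp
  qed
  show ?thesis
    unfolding matching_number_def
  proof (rule Max_eqI)
    show "finite {card M |M. matching (commuting_graph G) M}"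
      unfolding finite_nat_set_iff_bounded_le using le by blast
    show "card (carrier G) div 2 \<in> {card M |M. matching (commuting_graph G) M}"
      by (intro CollectI exI[of _ ?M] conjI M max[symmetric])
  qed (use le in blast)
qed

section \<open>Normal forms in the semidihedral group\<close>

definition sd_rel :: "nat \<Rightarrow> (sd_gen gword \<times> sd_gen gword) set" where
  "sd_rel n =
    {(replicate (4 * n) (Gen_a, True), []),
     ([(Gen_b, True), (Gen_b, True)], []),
     ([(Gen_b, True), (Gen_a, True)], replicate (2 * n - 1) (Gen_a, True) @ [(Gen_b, True)])}"

lemma SD_eq: "SD n = presented_group (sd_rel n)"
  by (simp add: SD_def sd_rel_def Let_def)

text \<open>
  A pair \<open>(i, s)\<close> with \<open>i < 4 * n\<close> stands for \<open>a ^ i * b ^ s\<close>. Letting words act on these pairs by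
  left multiplication shows that distinct normal forms are distinct in the presented group.
\<close>

fun sd_letter :: "nat \<Rightarrow> sd_gen \<times> bool \<Rightarrow> nat \<times> bool \<Rightarrow> nat \<times> bool" where
  "sd_letter n (Gen_a, True) (i, t) = ((i + 1) mod (4 * n), t)"
| "sd_letter n (Gen_a, False) (i, t) = ((i + (4 * n - 1)) mod (4 * n), t)"
| "sd_letter n (Gen_b, _) (i, t) = ((2 * n - 1) * i mod (4 * n), \<not> t)"

definition sd_act :: "nat \<Rightarrow> sd_gen gword \<Rightarrow> nat \<times> bool \<Rightarrow> nat \<times> bool" where
  "sd_act n w = foldr (sd_letter n) w"

definition sd_normal :: "nat \<Rightarrow> (nat \<times> bool) set" where
  "sd_normal n = {..<4 * n} \<times> UNIV"

definition sd_word :: "nat \<times> bool \<Rightarrow> sd_gen gword" where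
  "sd_word p = replicate (fst p) (Gen_a, True) @ (if snd p then [(Gen_b, True)] else [])"

definition sd_elem :: "nat \<Rightarrow> nat \<times> bool \<Rightarrow> sd_gen gword set" where
  "sd_elem n p = {w. gword_eq (sd_rel n) (sd_word p) w}"

lemma sd_act_Nil [simp]: "sd_act n [] p = p"
  and sd_act_Cons [simp]: "sd_act n (x # u) p = sd_letter n x (sd_act n u p)"
  and sd_act_append [simp]: "sd_act n (u @ v) p = sd_act n u (sd_act n v p)"
  by (simp_all add: sd_act_def)

text \<open>Lets a formal inverse be traded for a word in positive letters.\<close>

lemma gword_eq_inverse_letter:
  assumes "gword_eq R ((g, True) # u) []"
  shows "gword_eq R [(g, False)] u"
proof -
  have "gword_eq R ([(g, False)] @ ((g, True) # u)) ([(g, False)] @ [])"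
    by (intro gword_eq.append gword_eq.refl assms)
  moreover have "gword_eq R ([(g, False), (g, \<not> False)] @ u) ([] @ u)"
    by (intro gword_eq.append gword_eq.refl gword_eq.cancel)
  ultimately show ?thesis by (auto intro: gword_eq.trans gword_eq.sym)
qed

text \<open>Moves congruences to the integers, where the truncated subtraction in
  \<open>2 * n - 1\<close> becomes ring arithmetic.\<close>

lemma mod_eq_iff_int_dvd: "x mod N = y mod N \<longleftrightarrow> int N dvd int x - int y" for x y N :: nat
  by (simp flip: mod_eq_dvd_iff add: zmod_int[symmetric])

context
  fixes n :: nat
  assumes n: "n \<ge> 1"
begin

section \<open>The action of words on normal forms\<close>

lemma sd_letter_normal: "p \<in> sd_normal n \<Longrightarrow> sd_letter n x p \<in> sd_normal n"
  using n by (cases "(n, x, p)" rule: sd_letter.cases) (auto simp: sd_normal_def)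

lemma sd_act_normal: "p \<in> sd_normal n \<Longrightarrow> sd_act n u p \<in> sd_normal n"
  by (induction u) (auto simp: sd_letter_normal)

lemma sd_act_replicate:
  "i < 4 * n \<Longrightarrow> sd_act n (replicate k (Gen_a, True)) (i, t) = ((i + k) mod (4 * n), t)"
  by (induction k) (auto simp: mod_simps)

text \<open>\<open>(2 * n - 1)^2 = 1 + 4 * n * (n - 1)\<close>, so conjugation by \<open>b\<close>
  is an involution on exponents modulo \<open>4 * n\<close>.\<close>

lemma sd_square: "(2 * n - 1) * ((2 * n - 1) * i) mod (4 * n) = i mod (4 * n)"
proof -
  obtain k where k: "n = Suc k" using n by (cases n) auto
  have "(2 * n - 1) * ((2 * n - 1) * i) = i + (4 * n) * (k * i)"
    by (simp add: k algebra_simps)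
  then show ?thesis by simp
qed

lemma sd_letter_cancel:
  assumes "p \<in> sd_normal n"
  shows "sd_letter n (g, s) (sd_letter n (g, \<not> s) p) = p"
proof -
  obtain i t where p: "p = (i, t)" "i < 4 * n" using assms by (auto simp: sd_normal_def)
  have "(i + 1 + (4 * n - 1)) mod (4 * n) = i" "(i + (4 * n - 1) + 1) mod (4 * n) = i"
    using p n by simp_all
  then have "((i + 1) mod (4 * n) + (4 * n - 1)) mod (4 * n) = i"
      "((i + (4 * n - 1)) mod (4 * n) + 1) mod (4 * n) = i"
    by (simp_all only: mod_add_left_eq)
  moreover have "(2 * n - 1) * ((2 * n - 1) * i mod (4 * n)) mod (4 * n) = i"
    using p sd_square[of i] by (simp only: mod_mult_right_eq) simp
  ultimately show ?thesis
    using p by (cases g; cases s) (simp_all only: sd_letter.simps not_True_eq_False not_False_eq_True not_not)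
qed

text \<open>The action respects the congruence: apart from closure rules, only formal cancellation
  and the three relations have to be checked. Words that act differently are thus distinct in the
  group.\<close>

lemma sd_act_cong:
  assumes "gword_eq (sd_rel n) u v" "p \<in> sd_normal n"
  shows "sd_act n u p = sd_act n v p"
  using assms
proof (induction arbitrary: p rule: gword_eq.induct)
  case (append u u' v v')
  then show ?case by (simp add: sd_act_normal)
next
  case (cancel g s)
  then show ?case by (simp add: sd_letter_cancel)
next
  case (relation u v)
  obtain i t where p: "p = (i, t)" "i < 4 * n" using relation by (auto simp: sd_normal_def)
  \<comment> \<open>The exponents obtained by letting the two sides of
    \<open>b a = a^(2n-1) b\<close> act on \<open>p\<close>.\<close>
  have "(2 * n - 1) * ((i + 1) mod (4 * n)) mod (4 * n)
      = ((2 * n - 1) * i mod (4 * n) + (2 * n - 1)) mod (4 * n)"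
    by (simp only: mod_simps distrib_left mult_1_right)
  moreover have "(2 * n - 1) * ((2 * n - 1) * i mod (4 * n)) mod (4 * n) = i"
    using p sd_square[of i] by (simp only: mod_mult_right_eq) simp
  ultimately show ?case
    using relation p n
    by (auto simp: sd_rel_def sd_act_replicate)
qed simp_all

text \<open>The multiplication table of the normal forms; \<open>s \<noteq> t\<close> adds the
  exponents of \<open>b\<close> modulo 2.\<close>

lemma sd_act_word:
  "j < 4 * n \<Longrightarrow>
    sd_act n (sd_word (i, s)) (j, t) = ((i + (if s then (2 * n - 1) * j else j)) mod (4 * n), s \<noteq> t)"
  using n by (auto simp: sd_word_def sd_act_replicate mod_simps ac_simps)

text \<open>The pair \<open>(0, False)\<close> stands for the identity, so acting on it reads off
  the normal form of a word.\<close>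

lemma sd_act_word_0: "p \<in> sd_normal n \<Longrightarrow> sd_act n (sd_word p) (0, False) = p"
  using n by (cases p) (auto simp: sd_act_word sd_normal_def)

section \<open>Reduction of words to normal form\<close>

lemma gword_eq_replicate_mod:
  "gword_eq (sd_rel n) (replicate k (Gen_a, True)) (replicate (k mod (4 * n)) (Gen_a, True))"
proof (induction k rule: less_induct)
  case (less k)
  show ?case
  proof (cases "k < 4 * n")
    case False
    have "gword_eq (sd_rel n) (replicate (4 * n) (Gen_a, True)) []"
      by (rule gword_eq.relation) (simp add: sd_rel_def)
    then have "gword_eq (sd_rel n)
        (replicate (4 * n) (Gen_a, True) @ replicate (k - 4 * n) (Gen_a, True))
        ([] @ replicate (k - 4 * n) (Gen_a, True))"
      by (intro gword_eq.append gword_eq.refl)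
    then have "gword_eq (sd_rel n) (replicate k (Gen_a, True)) (replicate (k - 4 * n) (Gen_a, True))"
      using False by (simp flip: replicate_add)
    then show ?thesis
      using less[of "k - 4 * n"] False n by (auto simp: le_mod_geq intro: gword_eq.trans)
  qed (simp add: gword_eq.refl)
qed

lemma gword_eq_sd_word_mod:
  "gword_eq (sd_rel n) (replicate k (Gen_a, True) @ v) (replicate (k mod (4 * n)) (Gen_a, True) @ v)"
  by (intro gword_eq.append gword_eq.refl gword_eq_replicate_mod)

text \<open>Each \<open>a\<close> that \<open>b\<close> passes becomes \<open>2 * n - 1\<close>
  copies of \<open>a\<close>. The exponent stays unreduced here.\<close>

lemma gword_eq_b_past_a:
  "gword_eq (sd_rel n) ((Gen_b, True) # replicate i (Gen_a, True))
    (replicate ((2 * n - 1) * i) (Gen_a, True) @ [(Gen_b, True)])"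
proof (induction i)
  case (Suc i)
  let ?a = "(Gen_a, True)" and ?b = "(Gen_b, True)"
  have "gword_eq (sd_rel n) ([?b, ?a] @ replicate i ?a)
      ((replicate (2 * n - 1) ?a @ [?b]) @ replicate i ?a)"
    by (intro gword_eq.append gword_eq.refl gword_eq.relation) (simp add: sd_rel_def)
  moreover have "gword_eq (sd_rel n) (replicate (2 * n - 1) ?a @ (?b # replicate i ?a))
      (replicate (2 * n - 1) ?a @ (replicate ((2 * n - 1) * i) ?a @ [?b]))"
    by (intro gword_eq.append gword_eq.refl Suc)
  ultimately show ?case
    by (auto simp: replicate_add intro: gword_eq.trans)
qed (simp add: gword_eq.refl)

lemma gword_eq_letter_True:
  "gword_eq (sd_rel n) ((g, True) # sd_word p) (sd_word (sd_letter n (g, True) p))"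
proof -
  let ?a = "(Gen_a, True)" and ?b = "(Gen_b, True)"
  obtain i s where p: "p = (i, s)" by force
  show ?thesis
  proof (cases g)
    case Gen_a
    then show ?thesis
      using gword_eq_sd_word_mod[of "Suc i"] by (auto simp: p sd_word_def)
  next
    case Gen_b
    let ?k = "(2 * n - 1) * i"
    have *: "gword_eq (sd_rel n) (?b # sd_word p)
        (replicate ?k ?a @ (?b # (if s then [?b] else [])))"
      using gword_eq.append[OF gword_eq_b_past_a gword_eq.refl] by (simp add: p sd_word_def)
    have bb: "gword_eq (sd_rel n) [?b, ?b] []"
      by (rule gword_eq.relation) (simp add: sd_rel_def)
    have "gword_eq (sd_rel n) (replicate ?k ?a @ (?b # (if s then [?b] else [])))
        (replicate ?k ?a @ (if s then [] else [?b]))"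
      using bb by (intro gword_eq.append gword_eq.refl) (auto intro: gword_eq.refl)
    with * have "gword_eq (sd_rel n) (?b # sd_word p) (replicate ?k ?a @ (if s then [] else [?b]))"
      by (rule gword_eq.trans)
    from gword_eq.trans[OF this gword_eq_sd_word_mod] show ?thesis
      using Gen_b by (simp add: p sd_word_def split: if_splits)
  qed
qed

lemma gword_eq_word_True:
  "gword_eq (sd_rel n) (map (\<lambda>g. (g, True)) gs @ sd_word p)
    (sd_word (sd_act n (map (\<lambda>g. (g, True)) gs) p))"
proof (induction gs)
  case (Cons g gs)
  have "gword_eq (sd_rel n) ([(g, True)] @ (map (\<lambda>g. (g, True)) gs @ sd_word p))
      ([(g, True)] @ sd_word (sd_act n (map (\<lambda>g. (g, True)) gs) p))"
    by (intro gword_eq.append gword_eq.refl Cons)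
  from gword_eq.trans[OF this] gword_eq_letter_True show ?case by (simp del: split_paired_All)
qed (simp add: gword_eq.refl)

text \<open>A positive letter has been treated already. An inverse letter equals a positive word,
  and \<open>sd_act_cong\<close> shows that this word acts on \<open>p\<close> in the same
  way.\<close>

lemma gword_eq_letter:
  assumes "p \<in> sd_normal n"
  shows "gword_eq (sd_rel n) (x # sd_word p) (sd_word (sd_letter n x p))"
proof -
  obtain g s where x: "x = (g, s)" by force
  \<comment> \<open>Spells the inverse of \<open>g\<close> with positive letters:
    \<open>a^(4n-1)\<close> for \<open>a\<close>, and \<open>b\<close> for itself.\<close>
  define gs where "gs = (if g = Gen_a then replicate (4 * n - 1) Gen_a else [Gen_b])"
  let ?w = "map (\<lambda>g. (g, True)) gs"
  have "gword_eq (sd_rel n) ((g, True) # ?w) []"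
    using n by (intro gword_eq.relation, cases g)
      (auto simp: gs_def sd_rel_def simp flip: replicate_Suc)
  then have w: "gword_eq (sd_rel n) [(g, False)] ?w" by (rule gword_eq_inverse_letter)
  have "gword_eq (sd_rel n) ([(g, False)] @ sd_word p) (?w @ sd_word p)"
    by (intro gword_eq.append gword_eq.refl w)
  from gword_eq.trans[OF this gword_eq_word_True]
  have "gword_eq (sd_rel n) ((g, False) # sd_word p) (sd_word (sd_letter n (g, False) p))"
    using sd_act_cong[OF w assms] by simp
  then show ?thesis using gword_eq_letter_True by (cases s) (auto simp: x)
qed

lemma gword_eq_sd_word: "gword_eq (sd_rel n) u (sd_word (sd_act n u (0, False)))"
proof (induction u)
  case Nil
  show ?case by (simp add: sd_word_def gword_eq.refl)
next
  case (Cons x u)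
  have "(0, False) \<in> sd_normal n" using n by (simp add: sd_normal_def)
  then have "gword_eq (sd_rel n) (x # sd_word (sd_act n u (0, False)))
      (sd_word (sd_act n (x # u) (0, False)))"
    using gword_eq_letter[OF sd_act_normal] by simp
  moreover have "gword_eq (sd_rel n) ([x] @ u) ([x] @ sd_word (sd_act n u (0, False)))"
    by (intro gword_eq.append gword_eq.refl Cons)
  ultimately show ?case by (auto intro: gword_eq.trans)
qed

lemma gword_class_eq_sd_elem: "{w. gword_eq (sd_rel n) u w} = sd_elem n (sd_act n u (0, False))"
  unfolding sd_elem_def using gword_eq_sd_word[of u] by (blast intro: gword_eq.trans gword_eq.sym)

section \<open>Elements and products in normal form\<close>

text \<open>Injectivity comes from the action on \<open>(0, False)\<close>, surjectivity from the
  reduction of words.\<close>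

lemma bij_betw_sd_elem: "bij_betw (sd_elem n) (sd_normal n) (carrier (SD n))"
proof -
  have zero: "(0, False) \<in> sd_normal n" using n by (simp add: sd_normal_def)
  have "inj_on (sd_elem n) (sd_normal n)"
  proof (rule inj_onI)
    fix p q assume pq: "p \<in> sd_normal n" "q \<in> sd_normal n" "sd_elem n p = sd_elem n q"
    then have "gword_eq (sd_rel n) (sd_word p) (sd_word q)"
      unfolding sd_elem_def using gword_eq.refl by blast
    from sd_act_cong[OF this zero] show "p = q" using pq by (simp add: sd_act_word_0)
  qed
  moreover have "X \<in> sd_elem n ` sd_normal n" if "X \<in> carrier (SD n)" for X
  proof -
    obtain u where "X = sd_elem n (sd_act n u (0, False))"
      using \<open>X \<in> carrier (SD n)\<close> by (auto simp: SD_eq carrier_presented_group gword_class_eq_sd_elem)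
    then show ?thesis using sd_act_normal[OF zero] by blast
  qed
  moreover have "sd_elem n p \<in> carrier (SD n)" for p
    by (auto simp: SD_eq carrier_presented_group sd_elem_def)
  ultimately show ?thesis by (auto simp: bij_betw_def)
qed

lemma mult_sd_elem:
  assumes "q \<in> sd_normal n"
  shows "sd_elem n p \<otimes>\<^bsub>SD n\<^esub> sd_elem n q = sd_elem n (sd_act n (sd_word p) q)"
proof -
  have "sd_elem n p \<otimes>\<^bsub>SD n\<^esub> sd_elem n q = {w. gword_eq (sd_rel n) (sd_word p @ sd_word q) w}"
    unfolding SD_eq sd_elem_def by (rule mult_presented_group)
  then show ?thesis
    using assms by (simp only: gword_class_eq_sd_elem sd_act_append sd_act_word_0)
qed

lemma one_SD: "\<one>\<^bsub>SD n\<^esub> = sd_elem n (0, False)"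
  by (simp add: SD_eq one_presented_group sd_elem_def sd_word_def)

section \<open>Commutation and the center\<close>

definition sd_period :: nat where
  "sd_period = (if even n then 2 * n else n)"

text \<open>\<open>sd_period\<close> is \<open>4 * n\<close> divided by its gcd with
  \<open>2 * n - 2\<close>. For even \<open>n\<close> a factor 2 cancels and \<open>2 * n\<close> is
  coprime to \<open>n - 1\<close>; for \<open>n = 2 * k + 1\<close> a factor 4 cancels and
  \<open>n\<close> is coprime to \<open>k\<close>, because \<open>n - 2 * k = 1\<close>.\<close>

lemma dvd_sd_period: "4 * int n dvd (2 * int n - 2) * d \<longleftrightarrow> int sd_period dvd d"
proof (cases "even n")
  case True
  have "coprime (int n) (int n - 1)"
    using coprime_diff_one_left[of "int n"] by (simp add: ac_simps)
  moreover have "coprime 2 (int n - 1)" using True by simp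
  ultimately have "coprime (2 * int n) (int n - 1)" by simp
  then have "2 * int n dvd (int n - 1) * d \<longleftrightarrow> 2 * int n dvd d"
    by (rule coprime_dvd_mult_right_iff)
  moreover have "4 * int n dvd (2 * int n - 2) * d \<longleftrightarrow> 2 * (2 * int n) dvd 2 * ((int n - 1) * d)"
    by (simp add: algebra_simps)
  ultimately show ?thesis using True by (simp only: dvd_mult_cancel_left) (simp add: sd_period_def)
next
  case False
  then obtain k where k: "n = 2 * k + 1" by (elim oddE)
  have "coprime (int n) (int k)"
  proof (rule coprimeI)
    fix c assume "c dvd int n" "c dvd int k"
    then have "c dvd int n - 2 * int k" by (simp add: dvd_diff)
    then show "is_unit c" by (simp add: k)
  qed
  then have "int n dvd int k * d \<longleftrightarrow> int n dvd d" by (rule coprime_dvd_mult_right_iff)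
  moreover have "4 * int n dvd (2 * int n - 2) * d \<longleftrightarrow> 4 * int n dvd 4 * (int k * d)"
    by (simp add: k algebra_simps)
  ultimately show ?thesis using False by (simp only: dvd_mult_cancel_left) (simp add: sd_period_def)
qed

text \<open>The exponents of the two products differ, up to sign, by \<open>2 * n - 2\<close> times
  \<open>i\<close> or \<open>j\<close> if exactly one factor contains \<open>b\<close>, and times
  \<open>i - j\<close> if both do.\<close>

lemma sd_elem_commute_iff:
  assumes "(i, s) \<in> sd_normal n" "(j, t) \<in> sd_normal n"
  shows "sd_elem n (i, s) \<otimes>\<^bsub>SD n\<^esub> sd_elem n (j, t) = sd_elem n (j, t) \<otimes>\<^bsub>SD n\<^esub> sd_elem n (i, s) \<longleftrightarrow>
    (if s then if t then i mod sd_period = j mod sd_period else sd_period dvd j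
     else if t then sd_period dvd i else True)"
proof -
  have n1: "int (2 * n - 1) = 2 * int n - 1" using n by simp
  have mixed: "(i + j) mod (4 * n) = (j + (2 * n - 1) * i) mod (4 * n) \<longleftrightarrow> sd_period dvd i" for i j
  proof -
    have "int (i + j) - int (j + (2 * n - 1) * i) = - ((2 * int n - 2) * int i)"
      by (simp only: of_nat_add of_nat_mult n1) (simp add: algebra_simps)
    then show ?thesis using dvd_sd_period[of "int i"] by (simp add: mod_eq_iff_int_dvd)
  qed
  have reflections: "(i + (2 * n - 1) * j) mod (4 * n) = (j + (2 * n - 1) * i) mod (4 * n)
      \<longleftrightarrow> i mod sd_period = j mod sd_period"
  proof -
    have "int (i + (2 * n - 1) * j) - int (j + (2 * n - 1) * i) = (2 * int n - 2) * - (int i - int j)"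
      by (simp only: of_nat_add of_nat_mult n1) (simp add: algebra_simps)
    then show ?thesis
      using dvd_sd_period[of "- (int i - int j)"] by (simp add: mod_eq_iff_int_dvd del: minus_diff_eq)
  qed
  have "sd_elem n (i, s) \<otimes>\<^bsub>SD n\<^esub> sd_elem n (j, t) = sd_elem n (j, t) \<otimes>\<^bsub>SD n\<^esub> sd_elem n (i, s)
      \<longleftrightarrow> sd_act n (sd_word (i, s)) (j, t) = sd_act n (sd_word (j, t)) (i, s)"
    using assms sd_act_normal bij_betw_imp_inj_on[OF bij_betw_sd_elem]
    by (simp add: mult_sd_elem inj_on_eq_iff)
  then show ?thesis
    using assms mixed[of i j] mixed[of j i] reflections
    by (auto simp: sd_act_word sd_normal_def add.commute)
qed

lemma carrier_SD: "carrier (SD n) = sd_elem n ` sd_normal n"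
  using bij_betw_sd_elem by (simp add: bij_betw_def)

lemma finite_carrier_SD: "finite (carrier (SD n))"
  by (simp add: carrier_SD sd_normal_def)

lemma card_carrier_SD: "card (carrier (SD n)) = 8 * n"
  using bij_betw_same_card[OF bij_betw_sd_elem] by (simp add: sd_normal_def card_cartesian_product)

text \<open>The quantifier is left unevaluated so that the criterion also serves the abelian case
  \<open>n = 1\<close>.\<close>

lemma sd_elem_in_center:
  assumes "(i, s) \<in> sd_normal n"
  shows "sd_elem n (i, s) \<in> center (SD n) \<longleftrightarrow> (\<forall>(j, t) \<in> sd_normal n.
    if s then if t then i mod sd_period = j mod sd_period else sd_period dvd j
    else if t then sd_period dvd i else True)"
proof -
  have "sd_elem n (i, s) \<in> center (SD n) \<longleftrightarrow> (\<forall>q \<in> sd_normal n.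
      sd_elem n (i, s) \<otimes>\<^bsub>SD n\<^esub> sd_elem n q = sd_elem n q \<otimes>\<^bsub>SD n\<^esub> sd_elem n (i, s))"
    using assms by (simp add: center_def carrier_SD)
  also have "\<dots> \<longleftrightarrow> (\<forall>(j, t) \<in> sd_normal n.
      if s then if t then i mod sd_period = j mod sd_period else sd_period dvd j
      else if t then sd_period dvd i else True)"
  proof (rule ball_cong[OF HOL.refl])
    fix q assume "q \<in> sd_normal n"
    then show "sd_elem n (i, s) \<otimes>\<^bsub>SD n\<^esub> sd_elem n q = sd_elem n q \<otimes>\<^bsub>SD n\<^esub> sd_elem n (i, s)
      \<longleftrightarrow> (case q of (j, t) \<Rightarrow>
        if s then if t then i mod sd_period = j mod sd_period else sd_period dvd j
        else if t then sd_period dvd i else True)"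
      using sd_elem_commute_iff[OF assms, of "fst q" "snd q"] by (simp add: case_prod_beta)
  qed
  finally show ?thesis .
qed

lemma matching_number_SD: "matching_number (commuting_graph (SD n)) = 4 * n"
proof -
  interpret group "SD n" by (simp add: SD_eq group_presented_group)
  let ?z = "sd_elem n (2 * n, False)"
  have normal: "(2 * n, False) \<in> sd_normal n" "(0, False) \<in> sd_normal n"
    using n by (auto simp: sd_normal_def)
  \<comment> \<open>\<open>sd_period\<close> divides \<open>2 * n\<close> for either parity of
    \<open>n\<close>.\<close>
  have "?z \<in> center (SD n)"
    unfolding sd_elem_in_center[OF normal(1)] by (auto simp: sd_period_def)
  moreover have "?z \<otimes>\<^bsub>SD n\<^esub> ?z = \<one>\<^bsub>SD n\<^esub>"
    using n mult_sd_elem[OF normal(1), of "(2 * n, False)"] by (simp add: one_SD sd_act_word)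
  moreover have "?z \<noteq> \<one>\<^bsub>SD n\<^esub>"
    using n normal inj_on_eq_iff[OF bij_betw_imp_inj_on[OF bij_betw_sd_elem] normal]
    by (simp add: one_SD)
  ultimately show ?thesis
    using matching_number_commuting_graph[OF finite_carrier_SD, of ?z] card_carrier_SD by simp
qed

lemma center_SD_1:
  assumes "n = 1"
  shows "center (SD n) = carrier (SD n)"
proof -
  have "sd_period = 1" unfolding sd_period_def using assms by simp
  then have "sd_elem n p \<in> center (SD n)" if "p \<in> sd_normal n" for p
  proof -
    have "(fst p, snd p) \<in> sd_normal n" using that by simp
    from sd_elem_in_center[OF this] show ?thesis
      by (simp only: \<open>sd_period = 1\<close> prod.collapse mod_by_1 one_dvd) simp
  qed
  then have "carrier (SD n) \<subseteq> center (SD n)" unfolding carrier_SD by (rule image_subsetI)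
  with center_subset show ?thesis by (rule equalityI)
qed

text \<open>Labels the commutation classes of noncentral elements and serves as \<open>f\<close> in
  the graph lemmas; \<open>None\<close> labels the powers of \<open>a\<close>.\<close>

definition sd_class :: "sd_gen gword set \<Rightarrow> nat option" where
  "sd_class X = (let (i, s) = the_inv_into (sd_normal n) (sd_elem n) X
    in if s then Some (i mod sd_period) else None)"

lemma sd_class_elem:
  "(i, s) \<in> sd_normal n \<Longrightarrow>
    sd_class (sd_elem n (i, s)) = (if s then Some (i mod sd_period) else None)"
  using bij_betw_imp_inj_on[OF bij_betw_sd_elem]
  by (simp add: sd_class_def the_inv_into_f_f)

section \<open>The noncommutative case\<close>

context
  assumes n2: "n \<ge> 2"
begin

text \<open>The lower bound makes \<open>a\<close> noncentral; the upper bound keeps residues modulo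
  \<open>sd_period\<close> below \<open>4 * n\<close>.\<close>

lemma sd_period_bounds: "2 \<le> sd_period" "sd_period \<le> 2 * n"
  using n2 by (auto simp: sd_period_def)

lemma sd_elem_in_center_iff:
  assumes "(i, s) \<in> sd_normal n"
  shows "sd_elem n (i, s) \<in> center (SD n) \<longleftrightarrow> \<not> s \<and> sd_period dvd i"
proof -
  have "(\<forall>(j, t) \<in> sd_normal n.
      if s then if t then i mod sd_period = j mod sd_period else sd_period dvd j
      else if t then sd_period dvd i else True) \<longleftrightarrow> \<not> s \<and> sd_period dvd i" (is "?R \<longleftrightarrow> _")
  proof (intro iffI)
    assume R: ?R
    \<comment> \<open>It suffices to test against \<open>a\<close> and \<open>b\<close>: the first
      excludes \<open>s\<close>, the second forces the divisibility.\<close>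
    have "(1, False) \<in> sd_normal n" "(0, True) \<in> sd_normal n" using n by (auto simp: sd_normal_def)
    from bspec[OF R this(1)] bspec[OF R this(2)] show "\<not> s \<and> sd_period dvd i"
      using sd_period_bounds(1) by (cases s) simp_all
  qed auto
  then show ?thesis using sd_elem_in_center[OF assms] by simp
qed

text \<open>Only the mixed case needs noncentrality: a power of \<open>a\<close> that commutes with
  some \<open>a^j b\<close> has exponent divisible by \<open>sd_period\<close>, hence is
  central.\<close>

lemma sd_class_eq_iff:
  assumes "X \<in> carrier (SD n) - center (SD n)" "Y \<in> carrier (SD n) - center (SD n)"
  shows "X \<otimes>\<^bsub>SD n\<^esub> Y = Y \<otimes>\<^bsub>SD n\<^esub> X \<longleftrightarrow> sd_class X = sd_class Y"
proof -
  obtain p q where p: "X = sd_elem n p" "p \<in> sd_normal n"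
      and q: "Y = sd_elem n q" "q \<in> sd_normal n"
    using assms unfolding carrier_SD by blast
  obtain i s j t where ij: "p = (i, s)" "q = (j, t)" by fastforce
  have X: "(i, s) \<in> sd_normal n" and Y: "(j, t) \<in> sd_normal n" using p q ij by simp_all
  have "s \<or> \<not> sd_period dvd i" "t \<or> \<not> sd_period dvd j"
    using assms sd_elem_in_center_iff[OF X] sd_elem_in_center_iff[OF Y] unfolding p q ij by blast+
  then show ?thesis
    unfolding p q ij sd_elem_commute_iff[OF X Y] sd_class_elem[OF X] sd_class_elem[OF Y] by auto
qed

lemma sd_class_image:
  "sd_class ` (carrier (SD n) - center (SD n)) = insert None (Some ` {..<sd_period})"
proof (intro equalityI subsetI)
  fix c assume "c \<in> sd_class ` (carrier (SD n) - center (SD n))"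
  then show "c \<in> insert None (Some ` {..<sd_period})"
    using sd_period_bounds by (auto simp: carrier_SD sd_class_elem)
next
  fix c assume c: "c \<in> insert None (Some ` {..<sd_period})"
  \<comment> \<open>\<open>a\<close> represents the class of powers, and \<open>a^r b\<close> the
    class of residue \<open>r\<close>.\<close>
  define p where "p = (case c of None \<Rightarrow> (1, False) | Some r \<Rightarrow> (r, True))"
  have p: "p \<in> sd_normal n"
    using c n sd_period_bounds by (auto simp: p_def sd_normal_def)
  moreover have "sd_class (sd_elem n p) = c" "sd_elem n p \<notin> center (SD n)"
    using c p sd_period_bounds(1)
    by (auto simp: p_def sd_class_elem sd_elem_in_center_iff split: option.splits)
  ultimately show "c \<in> sd_class ` (carrier (SD n) - center (SD n))"
    unfolding carrier_SD by blast
qed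

text \<open>The center consists of the \<open>a^(sd_period * k)\<close> with exponent below
  \<open>4 * n\<close>, and \<open>4 * n\<close> is 2 or 4 times \<open>sd_period\<close>.\<close>

lemma card_center_SD: "card (center (SD n)) = (if even n then 2 else 4)"
proof -
  let ?c = "if even n then 2 else 4 :: nat" and ?h = "\<lambda>k. (sd_period * k, False)"
  have c: "sd_period * ?c = 4 * n" by (simp add: sd_period_def)
  have pos: "sd_period > 0" using sd_period_bounds by simp
  have lt: "sd_period * k < 4 * n \<longleftrightarrow> k < ?c" for k
    using pos by (simp only: c[symmetric] mult_less_cancel1 simp_thms)
  have "sd_elem n p \<in> center (SD n) \<longleftrightarrow> \<not> snd p \<and> sd_period dvd fst p" if "p \<in> sd_normal n" for p
    using that sd_elem_in_center_iff[of "fst p" "snd p"] by simp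
  then have "center (SD n) = sd_elem n ` {p \<in> sd_normal n. \<not> snd p \<and> sd_period dvd fst p}"
    using center_subset[of "SD n"] unfolding carrier_SD by blast
  also have "{p \<in> sd_normal n. \<not> snd p \<and> sd_period dvd fst p} = ?h ` {..<?c}"
  proof (intro equalityI subsetI)
    fix p assume "p \<in> {p \<in> sd_normal n. \<not> snd p \<and> sd_period dvd fst p}"
    then obtain k where "p = (sd_period * k, False)" "sd_period * k < 4 * n"
      by (cases p) (auto simp: sd_normal_def elim: dvdE)
    then show "p \<in> ?h ` {..<?c}" using lt[of k] by blast
  next
    fix p assume "p \<in> ?h ` {..<?c}"
    then obtain k where "p = ?h k" "sd_period * k < 4 * n" using lt by blast
    then show "p \<in> {p \<in> sd_normal n. \<not> snd p \<and> sd_period dvd fst p}"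
      by (simp add: sd_normal_def)
  qed
  finally have "center (SD n) = sd_elem n ` ?h ` {..<?c}" .
  moreover have "inj_on (sd_elem n) (?h ` {..<?c})"
    using bij_betw_imp_inj_on[OF bij_betw_sd_elem]
    by (rule inj_on_subset) (use lt in \<open>unfold sd_normal_def, blast\<close>)
  moreover have "inj_on ?h {..<?c}" using pos by (auto simp: inj_on_def)
  ultimately show ?thesis by (simp only: card_image card_lessThan)
qed

lemma vertex_connectivity_SD:
  "vertex_connectivity (commuting_graph (SD n)) = (if even n then 2 else 4)"
proof -
  \<comment> \<open>The classes of \<open>a\<close> and \<open>b\<close> provide the two vertices
    that deleting the center separates.\<close>
  have "None \<in> sd_class ` (carrier (SD n) - center (SD n))"
      "Some 0 \<in> sd_class ` (carrier (SD n) - center (SD n))"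
    using sd_period_bounds by (auto simp: sd_class_image)
  then obtain X Y where X: "X \<in> carrier (SD n) - center (SD n)" "sd_class X = None"
      and Y: "Y \<in> carrier (SD n) - center (SD n)" "sd_class Y = Some 0"
    by (elim imageE) metis
  have "vertex_connectivity (commuting_graph (SD n)) = card (center (SD n))"
  proof (rule vertex_connectivity_commuting_graph[where f = sd_class])
    show "monoid (SD n)" by (simp add: SD_eq group_presented_group group.is_monoid)
    show "sd_class X \<noteq> sd_class Y" using X Y by simp
  qed (fact finite_carrier_SD sd_class_eq_iff X Y)+
  then show ?thesis by (simp only: card_center_SD)
qed

text \<open>The extra 1 counts the class of noncentral powers of \<open>a\<close>.\<close>

lemma independence_number_SD: "independence_number (commuting_graph (SD n)) = sd_period + 1"
proof -
  have "independence_number (commuting_graph (SD n))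
      = card (sd_class ` (carrier (SD n) - center (SD n)))"
  proof (rule independence_number_commuting_graph[where f = sd_class])
    show "center (SD n) \<noteq> carrier (SD n)" using sd_class_image by auto
  qed (fact finite_carrier_SD, fact sd_class_eq_iff)
  also have "\<dots> = sd_period + 1"
    unfolding sd_class_image by (subst card_insert_disjoint) (auto simp: card_image)
  finally show ?thesis .
qed

end

end

theorem theorem4p14:
  fixes n :: nat
  assumes "n \<ge> 1"
  shows "(n \<ge> 2 \<longrightarrow>
            vertex_connectivity (commuting_graph (SD n)) = (if even n then 2 else 4))
       \<and> independence_number (commuting_graph (SD n)) =
            (if n = 1 then 1 else if even n then 2 * n + 1 else n + 1)
       \<and> matching_number (commuting_graph (SD n)) = 4 * n"
proof (cases "n = 1")
  case True
  have "monoid (SD n)" by (simp add: SD_eq group_presented_group group.is_monoid)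
  then show ?thesis
    using True assms matching_number_SD independence_number_commutative[OF _ center_SD_1] by simp
next
  case False
  with assms have "n \<ge> 2" by simp
  then show ?thesis
    using False assms matching_number_SD vertex_connectivity_SD independence_number_SD
    by (simp add: sd_period_def)
qed

end
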